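(* Let $(X,d)$ be a complete metric space and let $f:X\to[0,\infty]$ be proper and lower semicontinuous. For $x_0\in\mathrm{dom}(f)$ and $r>0$ define $$\alpha=\alpha(x_0,r):=\inf\left\{\frac{|D^-f|(x)^2}{f(x)} : x\in B_r(x_0),\ 0<f(x)\le f(x_0)\right\}.$$ Suppose that $\alpha(x_0,r)>4f(x_0)/r^2$ for some $x_0\in\mathrm{dom}(f)$ and $r>0$. Suppose further that there exists $\bar\tau>0$ such that, for all $x\in B_r(x_0)\cap\{f\le f(x_0)\}$ and all $\tau\in(0,\bar\tau)$, the functional $$X\ni y\longmapsto f(y)+\frac1{2\tau}d(x,y)^2$$ has at least one global minimiser. Then for any step-size $\tau\in(0,\bar\tau)$ there exists an infinite proximal point sequence starting from $x_0$ with step-size $\tau$. Moreover, for any such sequence $(y_k)_{k=0}^\infty$ the following statements hold: (i) (confinement) $y_k\in B_r(x_0)$ for all $k\ge0$; (ii) (convergence) $y_\infty:=\lim_{k\to\infty}y_k$ exists and belongs to $B_r(x_0)$. Moreover, $f(y_\infty)=0$; (iii) (convergence rates) for all $k\ge0$, $$f(y_k)\le(1+\alpha\tau)^{-k}f(x_0)\qquad\text{and}\qquad d(y_k,y_\infty)\le(1+\alpha\tau)^{-k/2}\,r .$$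
   Context: $B_r(x_0)$ is the open ball of radius $r$ around $x_0$. $\mathrm{dom}(f)=\{x: f(x)<\infty\}$, and $f$ is proper if $\mathrm{dom}(f)\ne\emptyset$. Conventions: $\inf\emptyset=+\infty$; if $\alpha=+\infty$ then $(1+\alpha\tau)^{-s}=0$ for $s>0$ and $=1$ for $s=0$. Slope: $|D^-f|(x):=\limsup_{y\to x}\frac{[f(y)-f(x)]_-}{d(y,x)}$ with $a_-=\max\{-a,0\}$; by convention $|D^-f|(x)=0$ if $x\in\mathrm{dom}(f)$ is isolated and $|D^-f|(x)=+\infty$ if $x\notin\mathrm{dom}(f)$. A proximal point sequence starting from $x_0$ with step-size $\tau>0$ is a (finite or infinite) sequence $(y_k)$ in $X$ with $y_0=x_0$ and $y_{k+1}\in\arg\min_{x\in X}\{f(x)+\frac1{2\tau}d(y_k,x)^2\}$ for every $k$. *)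

theory Defs
  imports "HOL-Analysis.Analysis"
begin

definition eff_dom :: "('a \<Rightarrow> ereal) \<Rightarrow> 'a set" where
  "eff_dom f = {x. f x < \<infinity>}"

definition proper :: "('a \<Rightarrow> ereal) \<Rightarrow> bool" where
  "proper f \<longleftrightarrow> eff_dom f \<noteq> {}"

(* The filter "at x" is punctured; at an isolated point the Liminf is \<infinity>, so the
   condition is vacuous there. *)
definition lower_semicontinuous :: "('a::topological_space \<Rightarrow> ereal) \<Rightarrow> bool" where
  "lower_semicontinuous f \<longleftrightarrow> (\<forall>x. f x \<le> Liminf (at x) f)"

definition neg_part :: "ereal \<Rightarrow> ereal" where
  "neg_part a = max (- a) 0"

(* "Isolated" means isolated in the whole space.  At a point of the domain that is isolated
   only within the domain, the Limsup is 0 anyway, since the negative part vanishes wherever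
   f y = \<infinity>. *)
definition descending_slope :: "('a::metric_space \<Rightarrow> ereal) \<Rightarrow> 'a \<Rightarrow> ereal" where
  "descending_slope f x =
     (if x \<notin> eff_dom f then \<infinity>
      else if \<not> x islimpt UNIV then 0
      else Limsup (at x) (\<lambda>y. neg_part (f y - f x) / ereal (dist y x)))"

(* Inf {} = \<infinity> in ereal, as required by the convention on empty infima. *)
definition slope_const :: "('a::metric_space \<Rightarrow> ereal) \<Rightarrow> 'a \<Rightarrow> real \<Rightarrow> ereal" where
  "slope_const f x0 r =
     Inf {(descending_slope f x)\<^sup>2 / f x | x. x \<in> ball x0 r \<and> 0 < f x \<and> f x \<le> f x0}"

definition prox_functional :: "('a::metric_space \<Rightarrow> ereal) \<Rightarrow> real \<Rightarrow> 'a \<Rightarrow> 'a \<Rightarrow> ereal" where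
  "prox_functional f \<tau> x y = f y + ereal (1 / (2 * \<tau>) * (dist x y)\<^sup>2)"

definition global_minimiser :: "('a \<Rightarrow> ereal) \<Rightarrow> 'a \<Rightarrow> bool" where
  "global_minimiser g z \<longleftrightarrow> is_arg_min g (\<lambda>_. True) z"

(* Infinite proximal point sequences y 0, y 1, ... *)
definition proximal_point_seq ::
    "('a::metric_space \<Rightarrow> ereal) \<Rightarrow> real \<Rightarrow> 'a \<Rightarrow> (nat \<Rightarrow> 'a) \<Rightarrow> bool" where
  "proximal_point_seq f \<tau> x0 y \<longleftrightarrow>
     y 0 = x0 \<and> (\<forall>k. global_minimiser (prox_functional f \<tau> (y k)) (y (Suc k)))"

(* The factor (1 + \<alpha> \<tau>) to the power -s, for 0 \<le> \<alpha> \<le> \<infinity>, \<tau> > 0 and s \<ge> 0. *)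
definition decay :: "ereal \<Rightarrow> real \<Rightarrow> real \<Rightarrow> real" where
  "decay \<alpha> \<tau> s =
     (if \<alpha> = \<infinity> then (if s = 0 then 1 else 0)
      else (1 + real_of_ereal \<alpha> * \<tau>) powr (- s))"

end

theory Submission
  imports Defs
begin

text \<open>
  Write \<open>h = sqrt f\<close>.  Where \<open>f\<close> is positive, \<open>|D\<^sup>-f|\<^sup>2 \<ge> \<beta> f\<close> says that the slope of \<open>h\<close> is at
  least \<open>b = sqrt \<beta> / 2\<close>, and \<open>\<beta> > 4 f(x0) / r\<^sup>2\<close> says that \<open>h x0 < b r\<close>.  Everything follows from
  two facts about a minimiser \<open>y'\<close> of \<open>f + d(y, \<cdot>)\<^sup>2 / (2 \<tau>)\<close>.

  First, \<open>y'\<close> is a nearest point to \<open>y\<close> of the sublevel set \<open>{f \<le> f y'}\<close>.  Ekeland's variational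
  principle, applied to \<open>h\<close> cut off from below at \<open>h y'\<close>, finds a point of this set at distance at
  most \<open>(h y - h y') / c\<close> from \<open>y\<close>, for each \<open>c < b\<close> close to \<open>b\<close>.  Hence
  \<open>b d(y, y') \<le> h y - h y'\<close>.  Summing over the steps confines the sequence to the ball and makes
  it a Cauchy sequence.

  Second, \<open>|D\<^sup>-f|(y') \<le> d(y, y') / \<tau>\<close>, so that \<open>2 b \<tau> h y' \<le> d(y, y')\<close>.  Together with the first fact,
  \<open>(1 + 2 b\<^sup>2 \<tau>) h y' \<le> h y\<close>; squaring gives \<open>(1 + \<beta> \<tau>) f y' \<le> f y\<close>.  In particular no variational
  interpolation between \<open>y\<close> and \<open>y'\<close> with smaller step sizes is needed.

  The resulting rates hold for all real \<open>\<beta> \<le> \<alpha>\<close> with \<open>\<beta> > 4 f(x0) / r\<^sup>2\<close>.  One takes \<open>\<beta> = \<alpha>\<close> if \<open>\<alpha>\<close> is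
  finite and lets \<open>\<beta>\<close> tend to infinity otherwise.
\<close>

section \<open>Ekeland's variational principle\<close>

lemma closed_sublevel:
  assumes "lower_semicontinuous f"
  shows "closed {x. f x \<le> a}"
proof -
  have "open {x. a < f x}"
  proof (subst open_subopen, clarify)
    fix x assume x: "a < f x"
    with assms have "a < Liminf (at x) f"
      by (auto simp: lower_semicontinuous_def intro: less_le_trans)
    then have "\<forall>\<^sub>F w in at x. a < f w"
      by (rule less_LiminfD)
    with x have "\<forall>\<^sub>F w in nhds x. a < f w"
      by (auto simp: eventually_at_filter elim!: eventually_mono)
    then show "\<exists>T. open T \<and> x \<in> T \<and> T \<subseteq> {x. a < f x}"
      by (auto simp: eventually_nhds)
  qed
  moreover have "{x. f x \<le> a} = - {x. a < f x}" by auto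
  ultimately show ?thesis by (simp add: closed_def)
qed

text \<open>
  A sequence whose steps are controlled by the decrease of a quantity bounded below converges, and
  the remaining decrease controls the distance to the limit.
\<close>
lemma descent_convergent:
  fixes x :: "nat \<Rightarrow> 'a::complete_space" and u :: "nat \<Rightarrow> real"
  assumes c: "0 < c" and step: "\<And>n. c * dist (x n) (x (Suc n)) \<le> u n - u (Suc n)"
    and bdd: "\<And>n. m \<le> u n"
  obtains z L where "x \<longlonglongrightarrow> z" "u \<longlonglongrightarrow> L" "\<And>n. L \<le> u n" "\<And>n. c * dist (x n) z \<le> u n - L"
proof -
  have mono: "u (Suc n) \<le> u n" for n
    using step[of n] c by (smt (verit) mult_nonneg_nonneg zero_le_dist)
  then have "decseq u" by (simp add: decseq_Suc_iff)
  then obtain L where L: "u \<longlonglongrightarrow> L" "\<And>n. L \<le> u n"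
    using decseq_convergent[of u m] bdd by metis
  have tele: "c * dist (x n) (x (n + k)) \<le> u n - u (n + k)" for n k
  proof (induction k)
    case (Suc k)
    have "c * dist (x n) (x (n + Suc k)) \<le> c * (dist (x n) (x (n + k)) + dist (x (n + k)) (x (n + Suc k)))"
      using c by (intro mult_left_mono dist_triangle) auto
    with Suc step[of "n + k"] show ?case by (simp add: algebra_simps)
  qed auto
  have "Cauchy x"
  proof (rule metric_CauchyI)
    fix e :: real assume "0 < e"
    with c have "0 < e * c / 2" by simp
    with L(1) have "\<forall>\<^sub>F n in sequentially. u n < L + e * c / 2"
      by (intro order_tendstoD) auto
    then obtain N where N: "u N < L + e * c / 2" by (auto simp: eventually_sequentially)
    have near: "dist (x N) (x n) < e / 2" if "n \<ge> N" for n
    proof -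
      have "c * dist (x N) (x n) < c * (e / 2)"
        using tele[of N "n - N"] that L(2)[of n] N by (simp add: mult.commute)
      with c show ?thesis by simp
    qed
    show "\<exists>M. \<forall>m\<ge>M. \<forall>n\<ge>M. dist (x m) (x n) < e"
      using near dist_triangle_half_r by blast
  qed
  then obtain z where z: "x \<longlonglongrightarrow> z" by (meson Cauchy_convergent_iff convergentD)
  have "c * dist (x n) z \<le> u n - L" for n
  proof (rule LIMSEQ_le)
    show "(\<lambda>k. c * dist (x n) (x (k + n))) \<longlonglongrightarrow> c * dist (x n) z"
      by (intro tendsto_intros LIMSEQ_ignore_initial_segment z)
    show "(\<lambda>k. u n - u (k + n)) \<longlonglongrightarrow> u n - L"
      by (intro tendsto_intros LIMSEQ_ignore_initial_segment L)
  qed (use tele[of n] in \<open>auto simp: add.commute\<close>)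
  with z L that show thesis by blast
qed

text \<open>
  The set \<open>K\<close> allows \<open>H\<close> to be real valued: it is going to be a sublevel set on which \<open>f\<close> is finite.
  Lower semicontinuity of \<open>H\<close> on \<open>K\<close>, and closedness of \<open>K\<close> wherever it matters, are expressed by
  the closedness of the sublevel sets.
\<close>
lemma ekeland:
  fixes H :: "'a::complete_space \<Rightarrow> real"
  assumes lsc: "\<And>a. closed {x \<in> K. H x \<le> a}" and bdd: "\<And>x. x \<in> K \<Longrightarrow> m \<le> H x"
    and y: "y \<in> K" and c: "0 < c"
  obtains z where "z \<in> K" "H z + c * dist y z \<le> H y"
    "\<And>w. w \<in> K \<Longrightarrow> w \<noteq> z \<Longrightarrow> H z < H w + c * dist w z"
proof -
  define S where "S x = {w \<in> K. H w + c * dist x w \<le> H x}" for x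
  have self: "x \<in> S x" if "x \<in> K" for x using that by (simp add: S_def)
  have bddS: "bdd_below (H ` S x)" for x using bdd by (auto simp: S_def intro!: bdd_belowI[of _ m])
  have ex: "\<exists>w. w \<in> S x \<and> H w < Inf (H ` S x) + (1/2)^n" if "x \<in> K" for x and n :: nat
    using cInf_lessD[of "H ` S x" "Inf (H ` S x) + (1/2)^n"] self[OF that] by auto
  \<comment> \<open>Each next point almost minimises \<open>H\<close> over the set of points improving on the current one.\<close>
  have "\<exists>x. \<forall>n. (x n \<in> K \<and> (n = 0 \<longrightarrow> x n = y)) \<and>
      (x (Suc n) \<in> S (x n) \<and> H (x (Suc n)) < Inf (H ` S (x n)) + (1/2)^n)"
    using ex y
    by (intro dependent_nat_choice[where P = "\<lambda>n x. x \<in> K \<and> (n = 0 \<longrightarrow> x = y)"])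
       (fastforce simp: S_def)+
  then obtain x where x0: "x 0 = y" and xK: "\<And>n. x n \<in> K" and xS: "\<And>n. x (Suc n) \<in> S (x n)"
    and xI: "\<And>n. H (x (Suc n)) < Inf (H ` S (x n)) + (1/2)^n" by auto
  obtain z L where z: "x \<longlonglongrightarrow> z" and L: "(\<lambda>n. H (x n)) \<longlonglongrightarrow> L"
    and dL: "\<And>n. c * dist (x n) z \<le> H (x n) - L"
  proof -
    have "c * dist (x n) (x (Suc n)) \<le> H (x n) - H (x (Suc n))" for n
      using xS[of n] by (simp add: S_def)
    then show thesis
      by (rule descent_convergent[OF c, of x "\<lambda>n. H (x n)", OF _ bdd[OF xK]]) (rule that)
  qed
  have zL: "z \<in> K \<and> H z \<le> L + e" if "0 < e" for e
  proof -
    have "\<forall>\<^sub>F n in sequentially. H (x n) < L + e" using L that by (intro order_tendstoD) auto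
    then have "\<forall>\<^sub>F n in sequentially. x n \<in> {x \<in> K. H x \<le> L + e}"
      by eventually_elim (use xK in auto)
    from Lim_in_closed_set[OF lsc this _ z] show ?thesis by simp
  qed
  have zK: "z \<in> K" using zL[of 1] by simp
  have HzL: "H z \<le> L" by (rule field_le_epsilon) (use zL in auto)
  show thesis
  proof (rule that[OF zK])
    show "H z + c * dist y z \<le> H y" using dL[of 0] HzL x0 by simp
    fix w assume w: "w \<in> K" "w \<noteq> z"
    show "H z < H w + c * dist w z"
    proof (rule ccontr)
      assume "\<not> ?thesis"
      then have le: "H w + c * dist z w \<le> H z" by (simp add: dist_commute)
      \<comment> \<open>Such a \<open>w\<close> competes in every step of the construction, whence \<open>L \<le> H w\<close>.\<close>
      have "w \<in> S (x n)" for n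
      proof -
        have "c * dist (x n) w \<le> c * (dist (x n) z + dist z w)"
          using c by (intro mult_left_mono dist_triangle) auto
        with le dL[of n] HzL w show ?thesis by (simp add: S_def algebra_simps)
      qed
      then have lo: "H (x (Suc n)) \<le> H w + (1/2)^n" for n
        using xI[of n] cINF_lower[OF bddS, of w "x n"] by fastforce
      have "(\<lambda>n. H w + (1/2)^n) \<longlonglongrightarrow> H w + 0"
        by (intro tendsto_intros LIMSEQ_realpow_zero) auto
      from LIMSEQ_le[OF LIMSEQ_Suc[OF L] this] have "L \<le> H w" using lo by auto
      with le HzL have "c * dist z w \<le> 0" by simp
      with c w show False by (auto simp: mult_le_0_iff)
    qed
  qed
qed

section \<open>A slope bound as an error bound for sublevel sets\<close>

lemma descending_slope_le:
  assumes fin: "f x < \<infinity>" and nonneg: "0 \<le> f x" "\<And>w. 0 \<le> f w" and C: "0 \<le> C"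
    and ev: "\<forall>\<^sub>F w in at x. f x \<le> f w + ereal (C * dist w x)"
  shows "descending_slope f x \<le> ereal C"
proof (cases "x islimpt UNIV")
  case True
  obtain p where p: "f x = ereal p" using fin nonneg(1) by (cases "f x") auto
  have "\<forall>\<^sub>F w in at x. neg_part (f w - f x) / ereal (dist w x) \<le> ereal C"
    using ev eventually_neq_at_within[of x x UNIV]
  proof eventually_elim
    case (elim w)
    then have d: "0 < dist w x" by simp
    show ?case
    proof (cases "f w")
      case (real q)
      define m where "m = max (p - q) 0"
      have "m \<le> C * dist w x" using elim(1) d C real p by (simp add: m_def)
      moreover have "neg_part (f w - f x) = ereal m"
        using real p by (simp add: neg_part_def m_def max_def zero_ereal_def)
      ultimately show ?thesis using d by (simp add: divide_le_eq)
    next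
      case PInf
      then show ?thesis using p C d by (simp add: neg_part_def)
    next
      case MInf
      then show ?thesis using nonneg(2)[of w] by simp
    qed
  qed
  then have "Limsup (at x) (\<lambda>w. neg_part (f w - f x) / ereal (dist w x)) \<le> ereal C"
    by (rule Limsup_bounded)
  with True fin show ?thesis by (simp add: descending_slope_def eff_dom_def)
qed (use fin C in \<open>simp add: descending_slope_def eff_dom_def\<close>)

text \<open>The square root of \<open>f\<close> as a real function, meaningful only where \<open>f\<close> is nonnegative and finite.\<close>
definition sqrt_val :: "('a \<Rightarrow> ereal) \<Rightarrow> 'a \<Rightarrow> real" where
  "sqrt_val f x = sqrt (real_of_ereal (f x))"

lemma sqrt_val_nonneg: "0 \<le> f x \<Longrightarrow> 0 \<le> sqrt_val f x"
  by (simp add: sqrt_val_def real_of_ereal_pos)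

lemma sqrt_val_square: "0 \<le> f x \<Longrightarrow> f x < \<infinity> \<Longrightarrow> f x = ereal ((sqrt_val f x)\<^sup>2)"
  by (cases "f x") (auto simp: sqrt_val_def)

text \<open>
  If the slope of \<open>sqrt f\<close> is at least \<open>b\<close> near \<open>y\<close>, the sublevel set \<open>{sqrt f \<le> l}\<close> is met within
  distance \<open>(sqrt (f y) - l) / c\<close> of \<open>y\<close>, for \<open>c < b\<close>.  The point is an Ekeland point: if \<open>sqrt f\<close> were
  still above \<open>l\<close> there, its slope would be at most \<open>c\<close>.
\<close>
lemma sublevel_error_bound:
  fixes f :: "'a::complete_space \<Rightarrow> ereal"
  assumes nonneg: "\<And>x. 0 \<le> f x" and lsc: "lower_semicontinuous f" and fin: "f y < \<infinity>"
    and c: "0 < c" "c < b" and \<rho>: "sqrt_val f y < c * \<rho>"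
    and slope: "\<And>x. dist y x < \<rho> \<Longrightarrow> 0 < f x \<Longrightarrow> f x \<le> f y \<Longrightarrow>
                  ereal (2 * b * sqrt_val f x) \<le> descending_slope f x"
    and l: "0 \<le> l" "l \<le> sqrt_val f y"
  obtains z where "f z \<le> ereal (l\<^sup>2)" "c * dist y z \<le> sqrt_val f y - l"
proof -
  let ?h = "sqrt_val f"
  define K where "K = {x. f x \<le> f y}"
  have sq: "f x = ereal ((?h x)\<^sup>2)" and finK: "f x < \<infinity>" if "x \<in> K" for x
    using that nonneg fin by (auto simp: K_def intro!: sqrt_val_square intro: le_less_trans)
  have h0: "0 \<le> ?h x" for x using nonneg by (rule sqrt_val_nonneg)
  have closed: "closed {x \<in> K. max l (?h x) \<le> a}" for a
  proof (cases "l \<le> a")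
    case True
    have "?h x \<le> a \<longleftrightarrow> f x \<le> ereal (a\<^sup>2)" if "x \<in> K" for x
      using True l(1) h0[of x] sq[OF that] abs_le_square_iff[of "?h x" a] by simp
    with True have "{x \<in> K. max l (?h x) \<le> a} = {x. f x \<le> f y} \<inter> {x. f x \<le> ereal (a\<^sup>2)}"
      by (auto simp: K_def)
    with closed_sublevel[OF lsc] show ?thesis by (auto intro: closed_Int)
  qed auto
  obtain z where zK: "z \<in> K" and z: "max l (?h z) + c * dist y z \<le> max l (?h y)"
    and strict: "\<And>w. w \<in> K \<Longrightarrow> w \<noteq> z \<Longrightarrow> max l (?h z) < max l (?h w) + c * dist w z"
    by (rule ekeland[where K = K and H = "\<lambda>x. max l (?h x)" and m = l and y = y, OF closed _ _ c(1)])
       (auto simp: K_def)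
  have "f z \<le> ereal (l\<^sup>2)"
  proof (rule ccontr)
    assume "\<not> ?thesis"
    then have gt: "ereal (l\<^sup>2) < f z" by simp
    with sq[OF zK] have "l\<^sup>2 < (?h z)\<^sup>2" by simp
    with h0 have hz: "l < ?h z" using power2_less_imp_less by blast
    have "c * dist y z < c * \<rho>" using z hz l \<rho> h0[of z] by (simp add: max_def)
    with c have d: "dist y z < \<rho>" by simp
    \<comment> \<open>Near \<open>z\<close> the cut-off at \<open>l\<close> is inactive, so that Ekeland's inequality is about \<open>?h\<close> itself.\<close>
    have "\<forall>\<^sub>F w in at z. ereal (l\<^sup>2) < f w"
      using lsc gt by (auto simp: lower_semicontinuous_def intro: less_LiminfD less_le_trans)
    then have "\<forall>\<^sub>F w in at z. f z \<le> f w + ereal (2 * c * ?h z * dist w z)"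
      using eventually_neq_at_within[of z z UNIV]
    proof eventually_elim
      case (elim w)
      have nn: "0 \<le> 2 * c * ?h z * dist w z" using c h0[of z] by simp
      show ?case
      proof (cases "f w < f z")
        case True
        then have wK: "w \<in> K" using zK by (auto simp: K_def)
        have "l\<^sup>2 < (?h w)\<^sup>2" "(?h w)\<^sup>2 < (?h z)\<^sup>2"
          using elim(1) True sq[OF wK] sq[OF zK] by simp_all
        with h0 have lt: "l < ?h w" "?h w < ?h z"
          using power2_less_imp_less by blast+
        have "?h z - ?h w \<le> c * dist w z" using strict[OF wK elim(2)] hz lt by simp
        moreover have "?h z + ?h w \<le> 2 * ?h z" using lt by simp
        ultimately have "(?h z - ?h w) * (?h z + ?h w) \<le> (c * dist w z) * (2 * ?h z)"
          using lt h0[of w] c(1) by (intro mult_mono) auto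
        then have "(?h z)\<^sup>2 \<le> (?h w)\<^sup>2 + 2 * c * ?h z * dist w z"
          by (simp add: power2_eq_square algebra_simps)
        then show ?thesis using sq[OF wK] sq[OF zK] by simp
      next
        case False
        then show ?thesis using nn by (simp add: add_increasing2)
      qed
    qed
    then have "descending_slope f z \<le> ereal (2 * c * ?h z)"
      using finK[OF zK] nonneg c(1) h0[of z] by (intro descending_slope_le) auto
    moreover have "ereal (2 * b * ?h z) \<le> descending_slope f z"
    proof (rule slope[OF d])
      show "0 < f z" using gt by (rule le_less_trans[rotated]) simp
      show "f z \<le> f y" using zK by (simp add: K_def)
    qed
    ultimately have "ereal (2 * b * ?h z) \<le> ereal (2 * c * ?h z)" by (rule order_trans[rotated])
    then show False using hz l c by simp
  qed
  moreover have "c * dist y z \<le> ?h y - l" using z l by simp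
  ultimately show thesis by (rule that)
qed

section \<open>One proximal step\<close>

lemma minimiser_le:
  "global_minimiser (prox_functional f \<tau> y) y' \<Longrightarrow>
    prox_functional f \<tau> y y' \<le> prox_functional f \<tau> y w"
  by (simp add: global_minimiser_def is_arg_min_linorder)

lemma minimiser_descends:
  assumes "global_minimiser (prox_functional f \<tau> y) y'" "0 < \<tau>"
  shows "f y' \<le> f y"
proof -
  have "f y' \<le> f y' + ereal (1 / (2 * \<tau>) * (dist y y')\<^sup>2)"
    using assms(2) by (simp add: add_increasing2)
  also have "\<dots> \<le> f y" using minimiser_le[OF assms(1), of y] by (simp add: prox_functional_def)
  finally show ?thesis .
qed

lemma minimiser_nearest:
  assumes "global_minimiser (prox_functional f \<tau> y) y'" "0 < \<tau>"
    and fin: "0 \<le> f y'" "f y' < \<infinity>" and z: "0 \<le> f z" "f z \<le> f y'"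
  shows "dist y y' \<le> dist y z"
proof -
  obtain p q where "f y' = ereal p" "f z = ereal q" "q \<le> p"
    using fin z by (cases "f y'"; cases "f z") auto
  with minimiser_le[OF assms(1), of z]
  have "1 / (2 * \<tau>) * (dist y y')\<^sup>2 \<le> 1 / (2 * \<tau>) * (dist y z)\<^sup>2"
    by (simp add: prox_functional_def)
  with assms(2) have "(dist y y')\<^sup>2 \<le> (dist y z)\<^sup>2"
    by (simp add: divide_le_cancel)
  then show ?thesis by (rule power2_le_imp_le) simp
qed

lemma slope_at_minimiser:
  assumes min: "global_minimiser (prox_functional f \<tau> y) y'" and \<tau>: "0 < \<tau>"
    and nonneg: "\<And>x. 0 \<le> f x" and fin: "f y < \<infinity>"
  shows "descending_slope f y' \<le> ereal (dist y y' / \<tau>)"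
proof (rule ereal_le_epsilon2)
  fix e :: real assume e: "0 < e"
  let ?d = "dist y y'"
  have fin': "f y' < \<infinity>" using minimiser_descends[OF min \<tau>] fin by (rule le_less_trans)
  have "\<forall>\<^sub>F w in at y'. dist w y' < 2 * \<tau> * e"
    using e \<tau> by (auto simp: eventually_at intro!: exI[of _ "2 * \<tau> * e"])
  then have "\<forall>\<^sub>F w in at y'. f y' \<le> f w + ereal ((?d / \<tau> + e) * dist w y')"
  proof eventually_elim
    case (elim w)
    show ?case
    proof (cases "f w")
      case (real q)
      obtain p where p: "f y' = ereal p" using fin' nonneg[of y'] by (cases "f y'") auto
      have "p + 1 / (2 * \<tau>) * ?d\<^sup>2 \<le> q + 1 / (2 * \<tau>) * (dist y w)\<^sup>2"
        using minimiser_le[OF min, of w] real p by (simp add: prox_functional_def)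
      moreover have "(dist y w)\<^sup>2 \<le> (?d + dist w y')\<^sup>2"
        using dist_triangle[of y w y'] by (intro power_mono) (auto simp: dist_commute)
      then have "1 / (2 * \<tau>) * (dist y w)\<^sup>2 \<le> 1 / (2 * \<tau>) * (?d + dist w y')\<^sup>2"
        using \<tau> by (intro mult_left_mono) auto
      moreover have "1 / (2 * \<tau>) * (?d + dist w y')\<^sup>2 =
          1 / (2 * \<tau>) * ?d\<^sup>2 + (?d / \<tau> + dist w y' / (2 * \<tau>)) * dist w y'"
        using \<tau> by (simp add: field_simps power2_eq_square)
      moreover have "(?d / \<tau> + dist w y' / (2 * \<tau>)) * dist w y' \<le> (?d / \<tau> + e) * dist w y'"
        using elim \<tau> by (intro mult_right_mono) (auto simp: field_simps)
      ultimately have "p \<le> q + (?d / \<tau> + e) * dist w y'" by linarith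
      then show ?thesis using real p by simp
    qed (use nonneg[of w] in auto)
  qed
  then show "descending_slope f y' \<le> ereal (?d / \<tau>) + ereal e"
    using descending_slope_le[of f y' "?d / \<tau> + e"] fin' nonneg e \<tau> by simp
qed

text \<open>
  The two estimates for a single step.  The first is the error bound for the sublevel set
  \<open>{f \<le> f y'}\<close>, to which \<open>y'\<close> is a nearest point; the second combines it with the slope bound at \<open>y'\<close>.
\<close>
lemma prox_step:
  fixes f :: "'a::complete_space \<Rightarrow> ereal"
  assumes nonneg: "\<And>x. 0 \<le> f x" and lsc: "lower_semicontinuous f" and fin: "f y < \<infinity>"
    and b: "0 < b" and \<rho>: "sqrt_val f y < b * \<rho>"
    and slope: "\<And>x. dist y x < \<rho> \<Longrightarrow> 0 < f x \<Longrightarrow> f x \<le> f y \<Longrightarrow>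
                  ereal (2 * b * sqrt_val f x) \<le> descending_slope f x"
    and \<tau>: "0 < \<tau>" and min: "global_minimiser (prox_functional f \<tau> y) y'"
  shows "b * dist y y' \<le> sqrt_val f y - sqrt_val f y'"
    and "(1 + 4 * b\<^sup>2 * \<tau>) * (sqrt_val f y')\<^sup>2 \<le> (sqrt_val f y)\<^sup>2"
proof -
  let ?h = "sqrt_val f" and ?d = "dist y y'"
  have le: "f y' \<le> f y" by (rule minimiser_descends[OF min \<tau>])
  then have fin': "f y' < \<infinity>" using fin by (rule le_less_trans)
  have h0: "0 \<le> ?h y'" "0 \<le> ?h y" using nonneg by (auto intro: sqrt_val_nonneg)
  have sq: "f y = ereal ((?h y)\<^sup>2)" "f y' = ereal ((?h y')\<^sup>2)"
    using nonneg fin fin' by (auto intro: sqrt_val_square)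
  then have hle: "?h y' \<le> ?h y" using le h0 by (auto intro: power2_le_imp_le)
  have \<rho>0: "0 < \<rho>" using \<rho> h0(2) b by (smt (verit) mult_nonneg_nonpos)
  have below: "c * ?d \<le> ?h y - ?h y'" if c: "0 < c" "c < b" "?h y < c * \<rho>" for c
  proof -
    obtain z where z: "f z \<le> f y'" "c * dist y z \<le> ?h y - ?h y'"
      using sublevel_error_bound[OF nonneg lsc fin c slope h0(1) hle] sq(2) by auto
    have "?d \<le> dist y z"
      by (rule minimiser_nearest[OF min \<tau> nonneg fin' nonneg z(1)])
    with c have "c * ?d \<le> c * dist y z" by simp
    with z show ?thesis by simp
  qed
  \<comment> \<open>The constant \<open>b\<close> itself is reached by letting \<open>c\<close> increase to \<open>b\<close>.\<close>
  show drop: "b * ?d \<le> ?h y - ?h y'"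
  proof (rule ccontr)
    assume neg: "\<not> ?thesis"
    with hle have d: "0 < ?d" by (cases "y = y'") auto
    have "max ((?h y - ?h y') / ?d) (?h y / \<rho>) < b"
      using neg \<rho> d \<rho>0 by (simp add: divide_less_eq)
    then obtain c where c: "max ((?h y - ?h y') / ?d) (?h y / \<rho>) < c" "c < b"
      using dense by blast
    then have "?h y - ?h y' < c * ?d" "?h y < c * \<rho>" using d \<rho>0 by (auto simp: divide_less_eq)
    moreover have "0 < c" using c(1) h0(2) \<rho>0 by (smt (verit) divide_nonneg_pos)
    ultimately show False using below[of c] c(2) by simp
  qed
  have jump: "2 * b * \<tau> * ?h y' \<le> ?d"
  proof (cases "?h y' = 0")
    case False
    with h0 have "0 < f y'" by (simp add: sq(2))
    moreover have "b * ?d < b * \<rho>" using drop h0 \<rho> by simp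
    ultimately have "ereal (2 * b * ?h y') \<le> descending_slope f y'"
      using b le by (intro slope) auto
    also have "\<dots> \<le> ereal (?d / \<tau>)" by (rule slope_at_minimiser[OF min \<tau> nonneg fin])
    finally show ?thesis using \<tau> by (simp add: field_simps)
  qed auto
  have "b * (2 * b * \<tau> * ?h y') \<le> b * ?d" using jump b by simp
  with drop have "?h y' * (1 + 2 * b\<^sup>2 * \<tau>) \<le> ?h y" by (simp add: algebra_simps power2_eq_square)
  then have "(?h y' * (1 + 2 * b\<^sup>2 * \<tau>))\<^sup>2 \<le> (?h y)\<^sup>2"
    using h0 \<tau> by (intro power_mono) auto
  moreover have "(1 + 4 * b\<^sup>2 * \<tau>) * (?h y')\<^sup>2 \<le> (?h y' * (1 + 2 * b\<^sup>2 * \<tau>))\<^sup>2"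
  proof -
    have "1 + 4 * b\<^sup>2 * \<tau> \<le> (1 + 2 * b\<^sup>2 * \<tau>)\<^sup>2"
      using zero_le_power2[of "2 * b\<^sup>2 * \<tau>"] by (simp add: power2_eq_square algebra_simps)
    then show ?thesis by (simp add: power_mult_distrib mult.commute mult_left_mono)
  qed
  ultimately show "(1 + 4 * b\<^sup>2 * \<tau>) * (?h y')\<^sup>2 \<le> (?h y)\<^sup>2" by linarith
qed

section \<open>Proximal point sequences under a slope bound\<close>

text \<open>
  The slope condition, with \<open>f\<close> small enough at the centre of the ball, in terms of \<open>sqrt f\<close>.
\<close>
locale slope_bound =
  fixes f :: "'a::complete_space \<Rightarrow> ereal" and x0 :: 'a and r b :: real
  assumes nonneg: "\<And>x. 0 \<le> f x" and lsc: "lower_semicontinuous f" and fin: "f x0 < \<infinity>"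
    and b: "0 < b" and small: "sqrt_val f x0 < b * r"
    and slope: "\<And>x. x \<in> ball x0 r \<Longrightarrow> 0 < f x \<Longrightarrow> f x \<le> f x0 \<Longrightarrow>
                  ereal (2 * b * sqrt_val f x) \<le> descending_slope f x"
begin

text \<open>
  The invariant of a proximal point sequence started at \<open>x0\<close>: the distance travelled is paid for by
  the decrease of \<open>sqrt f\<close>.
\<close>
definition trapped :: "'a \<Rightarrow> bool" where
  "trapped y \<longleftrightarrow> f y \<le> f x0 \<and> b * dist x0 y + sqrt_val f y \<le> sqrt_val f x0"

lemma trapped_start: "trapped x0"
  by (simp add: trapped_def)

lemma trapped_in_ball:
  assumes "trapped y"
  shows "y \<in> ball x0 r"
proof -
  have "b * dist x0 y < b * r"
    using assms small sqrt_val_nonneg[of f y] nonneg[of y] by (simp add: trapped_def)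
  with b show ?thesis by simp
qed

lemma trapped_step:
  assumes y: "trapped y" and \<tau>: "0 < \<tau>" and min: "global_minimiser (prox_functional f \<tau> y) y'"
  shows "trapped y'" and "b * dist y y' \<le> sqrt_val f y - sqrt_val f y'"
    and "(1 + 4 * b\<^sup>2 * \<tau>) * (sqrt_val f y')\<^sup>2 \<le> (sqrt_val f y)\<^sup>2"
proof -
  have finy: "f y < \<infinity>" using y fin by (auto simp: trapped_def intro: le_less_trans)
  have \<rho>: "sqrt_val f y < b * (r - dist x0 y)"
    using y small by (simp add: trapped_def algebra_simps)
  have sl: "ereal (2 * b * sqrt_val f x) \<le> descending_slope f x"
    if "dist y x < r - dist x0 y" "0 < f x" "f x \<le> f y" for x
    using that y dist_triangle[of x0 x y] by (intro slope) (auto simp: trapped_def)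
  note step = prox_step[OF nonneg lsc finy b \<rho> sl \<tau> min]
  show "b * dist y y' \<le> sqrt_val f y - sqrt_val f y'" by (rule step)
  then have "b * (dist x0 y + dist y y') + sqrt_val f y' \<le> sqrt_val f x0"
    using y by (simp add: trapped_def algebra_simps)
  moreover have "b * dist x0 y' \<le> b * (dist x0 y + dist y y')"
    using b by (intro mult_left_mono dist_triangle) auto
  ultimately show "trapped y'"
    using minimiser_descends[OF min \<tau>] y by (auto simp: trapped_def)
  show "(1 + 4 * b\<^sup>2 * \<tau>) * (sqrt_val f y')\<^sup>2 \<le> (sqrt_val f y)\<^sup>2" by (rule step)
qed

lemma proximal_point_seq_exists:
  assumes \<tau>: "0 < \<tau>"
    and ex: "\<And>x. x \<in> ball x0 r \<Longrightarrow> f x \<le> f x0 \<Longrightarrow> \<exists>z. global_minimiser (prox_functional f \<tau> x) z"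
  shows "\<exists>y. proximal_point_seq f \<tau> x0 y"
proof -
  have "\<exists>y. \<forall>n. (trapped (y n) \<and> (n = 0 \<longrightarrow> y n = x0)) \<and>
      global_minimiser (prox_functional f \<tau> (y n)) (y (Suc n))"
  proof (rule dependent_nat_choice)
    show "\<exists>x. trapped x \<and> (0 = 0 \<longrightarrow> x = x0)" using trapped_start by blast
    fix x and n :: nat assume "trapped x \<and> (n = 0 \<longrightarrow> x = x0)"
    then show "\<exists>z. (trapped z \<and> (Suc n = 0 \<longrightarrow> z = x0)) \<and> global_minimiser (prox_functional f \<tau> x) z"
      using ex[of x] trapped_in_ball[of x] trapped_step(1)[OF _ \<tau>, of x]
      by (auto simp: trapped_def)
  qed
  then show ?thesis by (auto simp: proximal_point_seq_def)
qed

lemma proximal_point_seq_converges: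
  assumes \<tau>: "0 < \<tau>" and seq: "proximal_point_seq f \<tau> x0 y"
  shows "\<exists>z. y \<longlonglongrightarrow> z \<and> z \<in> ball x0 r \<and> f z = 0 \<and> (\<forall>k. y k \<in> ball x0 r \<and>
    f (y k) \<le> ereal ((1 + 4 * b\<^sup>2 * \<tau>) powr (- real k)) * f x0 \<and>
    dist (y k) z \<le> (1 + 4 * b\<^sup>2 * \<tau>) powr (- (real k / 2)) * r)"
proof -
  let ?h = "sqrt_val f" and ?q = "1 + 4 * b\<^sup>2 * \<tau>"
  have y0: "y 0 = x0" and min: "\<And>k. global_minimiser (prox_functional f \<tau> (y k)) (y (Suc k))"
    using seq by (auto simp: proximal_point_seq_def)
  have q: "1 < ?q" using b \<tau> by simp
  have trap: "trapped (y k)" for k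
    by (induction k) (use y0 trapped_start trapped_step(1)[OF _ \<tau> min] in auto)
  have h0: "0 \<le> ?h x" for x using nonneg by (rule sqrt_val_nonneg)
  have sq: "f (y k) = ereal ((?h (y k))\<^sup>2)" for k
    using trap[of k] fin nonneg by (intro sqrt_val_square) (auto simp: trapped_def intro: le_less_trans)
  have geo: "?q ^ k * (?h (y k))\<^sup>2 \<le> (?h x0)\<^sup>2" for k
  proof (induction k)
    case (Suc k)
    have "?q ^ k * (?q * (?h (y (Suc k)))\<^sup>2) \<le> ?q ^ k * (?h (y k))\<^sup>2"
      using q trapped_step(3)[OF trap \<tau> min, of k] by (intro mult_left_mono) auto
    with Suc show ?case by (simp add: mult_ac)
  qed (simp add: y0)
  have rate: "(?h (y k))\<^sup>2 \<le> ?q powr (- real k) * (?h x0)\<^sup>2" for k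
    using geo[of k] q by (simp add: powr_minus powr_realpow field_simps)
  have hrate: "?h (y k) \<le> ?q powr (- (real k / 2)) * ?h x0" for k
  proof (rule power2_le_imp_le)
    show "(?h (y k))\<^sup>2 \<le> (?q powr (- (real k / 2)) * ?h x0)\<^sup>2"
      using rate[of k] by (simp add: power_mult_distrib power2_eq_square[of "_ powr _"] flip: powr_add)
  qed (use h0 in auto)
  obtain z L where z: "y \<longlonglongrightarrow> z" and L: "(\<lambda>k. ?h (y k)) \<longlonglongrightarrow> L"
    and dL: "\<And>k. b * dist (y k) z \<le> ?h (y k) - L"
    using descent_convergent[OF b, of y "\<lambda>k. ?h (y k)" 0] trapped_step(2)[OF trap \<tau> min] h0
    by metis
  have "(\<lambda>k. ?q powr (- (real k / 2)) * ?h x0) \<longlonglongrightarrow> 0"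
  proof -
    have "(\<lambda>k. inverse (sqrt ?q) ^ k * ?h x0) \<longlonglongrightarrow> 0 * ?h x0"
      using q by (intro tendsto_mult tendsto_const LIMSEQ_realpow_zero) (auto simp: inverse_less_1_iff)
    moreover have "?q powr (- (real k / 2)) = inverse (sqrt ?q) ^ k" for k
    proof -
      have "?q powr (- (real k / 2)) = inverse ((?q powr (1/2)) powr real k)"
        by (simp add: powr_powr powr_minus)
      also have "\<dots> = inverse (sqrt ?q) ^ k"
        using less_trans[OF zero_less_one q] by (simp add: powr_half_sqrt powr_realpow power_inverse)
      finally show ?thesis .
    qed
    ultimately show ?thesis by simp
  qed
  then have h_lim: "(\<lambda>k. ?h (y k)) \<longlonglongrightarrow> 0"
    by (rule tendsto_sandwich[OF _ _ tendsto_const, rotated 2]) (use hrate h0 in auto)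
  with L have "L = 0" by (rule LIMSEQ_unique)
  with dL have dz: "b * dist (y k) z \<le> ?h (y k)" for k by simp
  have "f z \<le> 0 + ereal e" if e: "0 < e" for e
  proof -
    have "(\<lambda>k. (?h (y k))\<^sup>2) \<longlonglongrightarrow> 0\<^sup>2" by (intro tendsto_power h_lim)
    then have "\<forall>\<^sub>F k in sequentially. (?h (y k))\<^sup>2 < e" using e by (intro order_tendstoD) auto
    then have "\<forall>\<^sub>F k in sequentially. y k \<in> {x. f x \<le> ereal e}"
      by eventually_elim (simp add: sq)
    from Lim_in_closed_set[OF closed_sublevel[OF lsc] this _ z] show ?thesis by simp
  qed
  then have fz: "f z = 0"
    using nonneg[of z] by (metis antisym ereal_le_epsilon2)
  show ?thesis
  proof (intro exI[of _ z] conjI allI z fz)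
    have "b * dist x0 z < b * r" using dz[of 0] small y0 by simp
    then show "z \<in> ball x0 r" using b by simp
    show "y k \<in> ball x0 r" for k by (rule trapped_in_ball[OF trap])
    show "f (y k) \<le> ereal (?q powr (- real k)) * f x0" for k
      using rate[of k] sqrt_val_square[of f x0] nonneg fin by (simp add: sq)
    show "dist (y k) z \<le> ?q powr (- (real k / 2)) * r" for k
    proof -
      have "b * dist (y k) z \<le> ?q powr (- (real k / 2)) * ?h x0" using dz[of k] hrate[of k] by simp
      also have "\<dots> \<le> ?q powr (- (real k / 2)) * (b * r)"
        using small by (intro mult_left_mono) auto
      finally have "b * dist (y k) z \<le> b * (?q powr (- (real k / 2)) * r)" by (simp add: mult_ac)
      with b show ?thesis by simp
    qed
  qed
qed

end

section \<open>From the slope constant to the rates\<close>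

lemma slope_bound_of_slope_const:
  fixes f :: "'a::complete_space \<Rightarrow> ereal"
  assumes nonneg: "\<And>x. 0 \<le> f x" and lsc: "lower_semicontinuous f" and fin: "f x0 < \<infinity>"
    and r: "0 < r" and lo: "4 * f x0 / ereal (r\<^sup>2) < ereal \<beta>" and hi: "ereal \<beta> \<le> slope_const f x0 r"
  shows "slope_bound f x0 r (sqrt \<beta> / 2)" and "0 < \<beta>"
proof -
  let ?h = "sqrt_val f"
  have h0: "0 \<le> ?h x" for x using nonneg by (rule sqrt_val_nonneg)
  have sq0: "f x0 = ereal ((?h x0)\<^sup>2)" using nonneg fin by (intro sqrt_val_square)
  have lo': "4 * (?h x0)\<^sup>2 / r\<^sup>2 < \<beta>" using lo r by (simp add: sq0)
  then show \<beta>: "0 < \<beta>" by (smt (verit) divide_nonneg_nonneg zero_le_power2)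
  have "(2 * ?h x0)\<^sup>2 < (sqrt \<beta> * r)\<^sup>2"
    using lo' r \<beta> by (simp add: divide_less_eq power_mult_distrib)
  then have "2 * ?h x0 < sqrt \<beta> * r" by (rule power2_less_imp_less) (use r \<beta> in simp)
  then have small: "?h x0 < sqrt \<beta> / 2 * r" by simp
  have sl: "ereal (2 * (sqrt \<beta> / 2) * ?h x) \<le> descending_slope f x"
    if x: "x \<in> ball x0 r" "0 < f x" "f x \<le> f x0" for x
  proof -
    let ?s = "descending_slope f x"
    have sq: "f x = ereal ((?h x)\<^sup>2)"
      using x fin nonneg by (intro sqrt_val_square) (auto intro: le_less_trans)
    have hx: "0 < ?h x" using x(2) h0[of x] by (simp add: sq less_le)
    have s0: "0 \<le> ?s"
    proof (cases "x islimpt UNIV")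
      case True
      then have "at x \<noteq> bot" by (simp add: trivial_limit_within)
      then have "0 \<le> Limsup (at x) (\<lambda>y. neg_part (f y - f x) / ereal (dist y x))"
        by (intro le_Limsup always_eventually) (auto simp: neg_part_def zero_ereal_def[symmetric])
      then show ?thesis by (simp add: descending_slope_def)
    qed (simp add: descending_slope_def)
    have "slope_const f x0 r \<le> ?s\<^sup>2 / f x"
      unfolding slope_const_def using x by (intro Inf_lower) auto
    with hi have le: "ereal \<beta> \<le> ?s\<^sup>2 / ereal ((?h x)\<^sup>2)" by (simp add: sq)
    show ?thesis
    proof (cases ?s)
      case (real s)
      with le have "\<beta> \<le> s\<^sup>2 / (?h x)\<^sup>2" using hx by simp
      with hx have "\<beta> * (?h x)\<^sup>2 \<le> s\<^sup>2" by (simp add: le_divide_eq)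
      then have "(sqrt \<beta> * ?h x)\<^sup>2 \<le> s\<^sup>2" using \<beta> by (simp add: power_mult_distrib)
      moreover have "0 \<le> s" using s0 real by simp
      ultimately have "sqrt \<beta> * ?h x \<le> s" by (rule power2_le_imp_le)
      with real show ?thesis by simp
    qed (use s0 in auto)
  qed
  show "slope_bound f x0 r (sqrt \<beta> / 2)"
    by unfold_locales (use nonneg lsc fin \<beta> small sl in auto)
qed

text \<open>
  A bound valid for all large real \<open>\<beta> \<le> \<alpha>\<close> passes to \<open>\<alpha>\<close>, also for \<open>\<alpha> = \<infinity>\<close>.
\<close>
lemma le_decay_of_le_real_rates:
  assumes \<tau>: "0 < \<tau>" and s: "0 \<le> s"
    and le: "\<And>\<beta>. \<beta>0 \<le> \<beta> \<Longrightarrow> 0 < \<beta> \<Longrightarrow> ereal \<beta> \<le> \<alpha> \<Longrightarrow> a \<le> (1 + \<beta> * \<tau>) powr (- s) * C"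
    and \<beta>0: "0 < \<beta>0" "ereal \<beta>0 \<le> \<alpha>"
  shows "a \<le> decay \<alpha> \<tau> s * C"
proof (cases \<alpha>)
  case (real \<beta>)
  then show ?thesis using le[of \<beta>] \<beta>0 by (simp add: decay_def)
next
  case PInf
  show ?thesis
  proof (cases "s = 0")
    case True
    have "1 + \<beta>0 * \<tau> > 0" using \<beta>0 \<tau> by (simp add: add_pos_pos)
    then show ?thesis using le[of \<beta>0] \<beta>0 PInf True by (simp add: decay_def)
  next
    case False
    with s have "- s < 0" by simp
    moreover have "filterlim (\<lambda>\<beta>. 1 + \<beta> * \<tau>) at_top at_top"
      using \<tau> by (intro filterlim_tendsto_add_at_top[OF tendsto_const]
          filterlim_at_top_mult_tendsto_pos[OF tendsto_const] filterlim_ident)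
    ultimately have "((\<lambda>\<beta>. (1 + \<beta> * \<tau>) powr (- s) * C) \<longlongrightarrow> 0 * C) at_top"
      by (intro tendsto_mult tendsto_const tendsto_neg_powr)
    moreover have "\<forall>\<^sub>F \<beta> in at_top. a \<le> (1 + \<beta> * \<tau>) powr (- s) * C"
      using eventually_ge_at_top[of \<beta>0] by eventually_elim (use le \<beta>0 PInf in auto)
    ultimately have "a \<le> 0 * C" by (rule tendsto_lowerbound) simp
    with False PInf show ?thesis by (simp add: decay_def)
  qed
qed (use \<beta>0 in auto)

theorem corollary1p7:
  fixes f :: "'a::complete_space \<Rightarrow> ereal"
    and x0 :: 'a and r \<tau>bar :: real and \<alpha> :: ereal
  assumes nonneg: "\<And>x. 0 \<le> f x"
    and proper: "proper f"
    and lsc: "lower_semicontinuous f"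
    and x0: "x0 \<in> eff_dom f"
    and r: "0 < r"
    and alpha: "\<alpha> = slope_const f x0 r"
    and alpha_gt: "\<alpha> > 4 * f x0 / ereal (r\<^sup>2)"
    and taubar: "0 < \<tau>bar"
    and minimisers: "\<And>x \<tau>. x \<in> ball x0 r \<Longrightarrow> f x \<le> f x0 \<Longrightarrow> 0 < \<tau> \<Longrightarrow> \<tau> < \<tau>bar
          \<Longrightarrow> \<exists>z. global_minimiser (prox_functional f \<tau> x) z"
  shows "\<forall>\<tau>. 0 < \<tau> \<and> \<tau> < \<tau>bar \<longrightarrow>
      (\<exists>y. proximal_point_seq f \<tau> x0 y) \<and>
      (\<forall>y. proximal_point_seq f \<tau> x0 y \<longrightarrow>
         (\<forall>k. y k \<in> ball x0 r) \<and>
         (\<exists>y_inf. y \<longlonglongrightarrow> y_inf \<and> y_inf \<in> ball x0 r \<and> f y_inf = 0 \<and>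
            (\<forall>k. f (y k) \<le> ereal (decay \<alpha> \<tau> (real k)) * f x0 \<and>
                 dist (y k) y_inf \<le> decay \<alpha> \<tau> (real k / 2) * r)))"
proof (intro allI impI, elim conjE)
  fix \<tau> :: real assume \<tau>: "0 < \<tau>" "\<tau> < \<tau>bar"
  have fin: "f x0 < \<infinity>" using x0 by (simp add: eff_dom_def)
  then obtain p where p: "f x0 = ereal p" using nonneg[of x0] by (cases "f x0") auto
  \<comment> \<open>A real threshold is needed since \<open>\<alpha>\<close> may be infinite.\<close>
  obtain \<beta>0 where \<beta>0: "4 * f x0 / ereal (r\<^sup>2) < ereal \<beta>0" "ereal \<beta>0 \<le> \<alpha>"
  proof (cases \<alpha>)
    case PInf
    show thesis by (rule that[of "4 * p / r\<^sup>2 + 1"]) (use p r PInf in auto)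
  next
    case (real \<beta>)
    with alpha_gt show thesis by (intro that[of \<beta>]) auto
  next
    case MInf
    with alpha_gt show thesis by simp
  qed
  have bound: "slope_bound f x0 r (sqrt \<beta> / 2)" "0 < \<beta>" if "\<beta>0 \<le> \<beta>" "ereal \<beta> \<le> \<alpha>" for \<beta>
  proof -
    have "4 * f x0 / ereal (r\<^sup>2) < ereal \<beta>" using \<beta>0(1) that(1) by (auto intro: less_le_trans)
    from slope_bound_of_slope_const[OF nonneg lsc fin r this] that(2)
    show "slope_bound f x0 r (sqrt \<beta> / 2)" "0 < \<beta>" by (auto simp: alpha)
  qed
  interpret b0: slope_bound f x0 r "sqrt \<beta>0 / 2" by (rule bound) (use \<beta>0 in auto)
  have \<beta>0pos: "0 < \<beta>0" by (rule bound) (use \<beta>0 in auto)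
  show "(\<exists>y. proximal_point_seq f \<tau> x0 y) \<and>
      (\<forall>y. proximal_point_seq f \<tau> x0 y \<longrightarrow>
         (\<forall>k. y k \<in> ball x0 r) \<and>
         (\<exists>y_inf. y \<longlonglongrightarrow> y_inf \<and> y_inf \<in> ball x0 r \<and> f y_inf = 0 \<and>
            (\<forall>k. f (y k) \<le> ereal (decay \<alpha> \<tau> (real k)) * f x0 \<and>
                 dist (y k) y_inf \<le> decay \<alpha> \<tau> (real k / 2) * r)))"
  proof (intro conjI allI impI)
    show "\<exists>y. proximal_point_seq f \<tau> x0 y"
      by (rule b0.proximal_point_seq_exists) (use \<tau> minimisers in auto)
  next
    fix y k assume "proximal_point_seq f \<tau> x0 y"
    then show "y k \<in> ball x0 r" using b0.proximal_point_seq_converges[OF \<tau>(1)] by blast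
  next
    fix y assume seq: "proximal_point_seq f \<tau> x0 y"
    \<comment> \<open>The limit does not depend on \<open>\<beta>\<close>, so one \<open>z\<close> serves for all rates.\<close>
    obtain z where z: "y \<longlonglongrightarrow> z" "z \<in> ball x0 r" "f z = 0"
      using b0.proximal_point_seq_converges[OF \<tau>(1) seq] by blast
    have rates: "f (y k) \<le> ereal ((1 + \<beta> * \<tau>) powr (- real k)) * f x0"
        "dist (y k) z \<le> (1 + \<beta> * \<tau>) powr (- (real k / 2)) * r"
      if \<beta>: "\<beta>0 \<le> \<beta>" "ereal \<beta> \<le> \<alpha>" for \<beta> k
    proof -
      interpret slope_bound f x0 r "sqrt \<beta> / 2" by (rule bound[OF \<beta>])
      have eq: "4 * (sqrt \<beta> / 2)\<^sup>2 = \<beta>" using bound(2)[OF \<beta>] by (simp add: power_divide)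
      obtain z' where z': "y \<longlonglongrightarrow> z'"
        "\<And>k. f (y k) \<le> ereal ((1 + \<beta> * \<tau>) powr (- real k)) * f x0"
        "\<And>k. dist (y k) z' \<le> (1 + \<beta> * \<tau>) powr (- (real k / 2)) * r"
        using proximal_point_seq_converges[OF \<tau>(1) seq] unfolding eq by blast
      moreover have "z' = z" using z'(1) z(1) by (rule LIMSEQ_unique)
      ultimately show "f (y k) \<le> ereal ((1 + \<beta> * \<tau>) powr (- real k)) * f x0"
        "dist (y k) z \<le> (1 + \<beta> * \<tau>) powr (- (real k / 2)) * r" by auto
    qed
    have "f (y k) \<le> ereal (decay \<alpha> \<tau> (real k)) * f x0" for k
    proof -
      have fk: "f (y k) \<le> ereal ((1 + \<beta> * \<tau>) powr (- real k) * p)"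
        if "\<beta>0 \<le> \<beta>" "ereal \<beta> \<le> \<alpha>" for \<beta>
        using rates(1)[OF that, of k] by (simp add: p)
      from fk[of \<beta>0] obtain t where t: "f (y k) = ereal t"
        using \<beta>0(2) nonneg[of "y k"] by (cases "f (y k)") auto
      have "t \<le> decay \<alpha> \<tau> (real k) * p"
        by (rule le_decay_of_le_real_rates[OF \<tau>(1) _ _ \<beta>0pos \<beta>0(2)]) (use fk t in auto)
      then show ?thesis by (simp add: t p)
    qed
    moreover have "dist (y k) z \<le> decay \<alpha> \<tau> (real k / 2) * r" for k
      by (rule le_decay_of_le_real_rates[OF \<tau>(1) _ _ \<beta>0pos \<beta>0(2)]) (use rates(2) in auto)
    ultimately show "\<exists>y_inf. y \<longlonglongrightarrow> y_inf \<and> y_inf \<in> ball x0 r \<and> f y_inf = 0 \<and>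
            (\<forall>k. f (y k) \<le> ereal (decay \<alpha> \<tau> (real k)) * f x0 \<and>
                 dist (y k) y_inf \<le> decay \<alpha> \<tau> (real k / 2) * r)"
      using z by blast
  qed
qed

end
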